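(* For all $r\in\mathbb{N}$ and $n\in\mathbb{Z}$, $$\overline{c}_r(n)=\sum_{d\,\|\,r} c_d(n).$$
   Context: $\mathbb{N}$ is the set of positive integers. An integer $a$ is regular (mod $r$) if there is an integer $x$ with $a^2x\equiv a \pmod r$. Define $$\overline{c}_r(n)=\sum_{\substack{a \pmod r\\ a\text{ regular}\pmod r}}\exp(2\pi i a n/r),\qquad c_r(n)=\sum_{\substack{a \pmod r\\ \gcd(a,r)=1}}\exp(2\pi i a n/r)$$ (the latter is the usual Ramanujan sum), the sums being over the indicated elements $a$ of a complete residue system mod $r$ (e.g. $1\le a\le r$). A positive divisor $d$ of $r$ is a unitary divisor, written $d\,\|\,r$, if $\gcd(d,r/d)=1$. *)

theory Defs
  imports Complex_Main "HOL-Number_Theory.Cong"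
begin

definition regular_mod :: "nat \<Rightarrow> int \<Rightarrow> bool"
  where "regular_mod r a \<longleftrightarrow> (\<exists>x::int. [a\<^sup>2 * x = a] (mod int r))"

text \<open>
  The summation conditions and the summands below depend only on the residue class of
  \<open>a\<close> modulo \<open>r\<close>; as complete residue system we take \<open>1 \<le> a \<le> r\<close>.
  The modulus is meant to be positive: for \<open>r = 0\<close> both sums are empty.
\<close>

definition ramanujan_sum :: "nat \<Rightarrow> int \<Rightarrow> complex"
  where "ramanujan_sum r n =
    (\<Sum>a | a \<in> {1..int r} \<and> gcd a (int r) = 1.
       exp (2 * of_real pi * \<i> * of_int a * of_int n / of_nat r))"

definition regular_ramanujan_sum :: "nat \<Rightarrow> int \<Rightarrow> complex"
  where "regular_ramanujan_sum r n =
    (\<Sum>a | a \<in> {1..int r} \<and> regular_mod r a.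
       exp (2 * of_real pi * \<i> * of_int a * of_int n / of_nat r))"

definition unitary_divisor :: "nat \<Rightarrow> nat \<Rightarrow> bool"
  where "unitary_divisor d r \<longleftrightarrow> d > 0 \<and> d dvd r \<and> gcd d (r div d) = 1"

end

(*
  Writing g = gcd(a, r), a = b g and r = d g, the residue a is regular (mod r) iff d is a unitary
  divisor of r. Reducing the fraction a/r to b/d then matches the terms of the two sums.
*)
theory Submission
  imports Defs
begin

text \<open>Sort the fractions \<open>a / r\<close> in (0, 1] by their denominator \<open>d\<close>
  in lowest terms: each equals \<open>b / d\<close> for exactly one \<open>d\<close> dividing
  \<open>r\<close> and one \<open>b\<close> in \<open>{1..int d}\<close> coprime to
  \<open>d\<close>, and the exponential sees only the value of the fraction. Regularity of
  \<open>a\<close> depends on \<open>d\<close> alone, by \<open>regular_mod_mult_iff\<close>, so the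
  regular residues fill precisely the classes whose \<open>d\<close> is unitary, and each class
  contributes one Ramanujan sum.\<close>

text \<open>Cancelling \<open>g\<close> from the congruence and its modulus, and then the unit
  \<open>b\<close> modulo \<open>d\<close>, leaves \<open>b * g * x = 1\<close> modulo
  \<open>d\<close>. This is solvable iff \<open>b * g\<close> is a unit modulo \<open>d\<close>,
  which depends only on \<open>g\<close>.\<close>

lemma regular_mod_mult_iff:
  fixes b :: int and d g :: nat
  assumes "coprime b (int d)" and "g > 0"
  shows "regular_mod (d * g) (b * int g) \<longleftrightarrow> coprime d g"
proof -
  have "[(b * int g)\<^sup>2 * x = b * int g] (mod int (d * g)) \<longleftrightarrow> [(b * int g) * x = 1] (mod int d)" for x
  proof -
    have "(b * int g)\<^sup>2 * x - b * int g = (b * (b * int g * x - 1)) * int g"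
      by (simp add: power2_eq_square algebra_simps)
    then have "[(b * int g)\<^sup>2 * x = b * int g] (mod int (d * g)) \<longleftrightarrow>
        int d * int g dvd (b * (b * int g * x - 1)) * int g"
      by (simp add: cong_iff_dvd_diff)
    also have "\<dots> \<longleftrightarrow> int d dvd b * (b * int g * x - 1)"
      using \<open>g > 0\<close> by (subst dvd_mult_cancel_right) simp
    also have "\<dots> \<longleftrightarrow> int d dvd b * int g * x - 1"
      using assms(1) by (simp add: coprime_dvd_mult_right_iff coprime_commute)
    finally show ?thesis
      by (simp add: cong_iff_dvd_diff)
  qed
  then have "regular_mod (d * g) (b * int g) \<longleftrightarrow> coprime (b * int g) (int d)"
    unfolding regular_mod_def by (simp only: coprime_iff_invertible_int)
  then show ?thesis
    using assms(1) by (simp add: coprime_commute)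
qed

theorem theorem3p1:
  fixes r :: nat and n :: int
  assumes "r > 0"
  shows "regular_ramanujan_sum r n = (\<Sum>d | unitary_divisor d r. ramanujan_sum d n)"
proof -
  let ?D = "{d. unitary_divisor d r}"
  let ?B = "\<lambda>d. {b. b \<in> {1..int d} \<and> gcd b (int d) = 1}"
  let ?A = "{a. a \<in> {1..int r} \<and> regular_mod r a}"
  let ?e = "\<lambda>d (b::int). exp (2 * of_real pi * \<i> * of_int b * of_int n / of_nat d) :: complex"
  \<comment> \<open>\<open>?f\<close> reduces \<open>a / r\<close> to lowest terms, giving
    (denominator, numerator); \<open>?h\<close> expands \<open>b / d\<close> back to denominator
    \<open>r\<close>.\<close>
  let ?f = "\<lambda>a. (r div nat (gcd a (int r)), a div gcd a (int r))"
  let ?h = "\<lambda>(d, b). b * int (r div d)"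
  have unitaryD: "\<exists>g. g > 0 \<and> r = d * g \<and> d > 0 \<and> coprime d g" if "unitary_divisor d r" for d
    using that \<open>r > 0\<close> unfolding unitary_divisor_def coprime_iff_gcd_eq_1
    by (metis dvd_mult_div_cancel gr0I mult_0_right)
  have "finite ?D"
    by (rule finite_subset[OF _ finite_divisors_nat[OF \<open>r > 0\<close>]]) (auto simp: unitary_divisor_def)
  have "finite (?B d)" for d
    by (rule finite_subset[of _ "{1..int d}"]) auto
  then have "(\<Sum>d\<in>?D. ramanujan_sum d n) = (\<Sum>(d, b)\<in>Sigma ?D ?B. ?e d b)"
    unfolding ramanujan_sum_def using \<open>finite ?D\<close> by (subst sum.Sigma) auto
  also have "\<dots> = (\<Sum>a\<in>?A. ?e r a)"
  proof (rule sum.reindex_bij_witness[of _ ?f ?h])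
    fix p assume "p \<in> Sigma ?D ?B"
    then obtain d b where p: "p = (d, b)" and b: "1 \<le> b" "b \<le> int d" "coprime b (int d)"
      and "unitary_divisor d r"
      by (auto simp: coprime_iff_gcd_eq_1)
    then obtain g where g: "g > 0" "r = d * g" "d > 0" "coprime d g"
      using unitaryD by blast
    \<comment> \<open>The common factor is exactly \<open>g\<close> since \<open>b\<close> and
      \<open>d\<close> are coprime, so reducing the expanded fraction recovers
      \<open>(d, b)\<close>.\<close>
    have "gcd (b * int g) (int r) = int g"
      using b(3) g(2) by (simp add: gcd_mult_right gcd.commute)
    then show "?f (?h p) = p"
      using p g by simp
    have "regular_mod r (b * int g)"
      using regular_mod_mult_iff[OF b(3) g(1)] g by simp
    moreover have "1 \<le> b * int g"
      using b(1) g(1) mult_pos_pos[of b "int g"] by linarith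
    moreover have "b * int g \<le> int r"
      using b(2) g by (simp add: mult_right_mono)
    ultimately show "?h p \<in> ?A"
      using p g by simp
    show "?e r (?h p) = (case p of (d, b) \<Rightarrow> ?e d b)"
      using p g by (simp add: mult.assoc)
  next
    fix a assume "a \<in> ?A"
    then have a: "1 \<le> a" "a \<le> int r" "regular_mod r a"
      by auto
    define g where "g = nat (gcd a (int r))"
    then have g: "gcd a (int r) = int g" "g > 0"
      using \<open>r > 0\<close> by (auto simp: gcd_pos_int)
    then have "int g dvd a" "g dvd r"
      by (metis gcd_dvd1, metis gcd_dvd2 int_dvd_int_iff)
    then obtain b d where bd: "a = b * int g" "r = d * g"
      by (metis dvdE mult.commute)
    have "d > 0"
      using bd(2) \<open>r > 0\<close> by auto
    have "coprime (a div gcd a (int r)) (int r div gcd a (int r))"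
      using \<open>r > 0\<close> by (intro div_gcd_coprime) auto
    then have cop: "coprime b (int d)"
      using g bd by simp
    \<comment> \<open>The converse use of the lemma: regularity of \<open>a\<close> forces its
      reduced denominator to be unitary.\<close>
    have "coprime d g"
      using a(3) regular_mod_mult_iff[OF cop g(2)] bd by simp
    then have "unitary_divisor d r"
      using bd(2) g(2) \<open>d > 0\<close> by (simp add: unitary_divisor_def)
    \<comment> \<open>Both ranges describe fractions in (0, 1]; the endpoint \<open>a = r\<close>
      corresponds to \<open>d = 1\<close>, \<open>b = 1\<close>.\<close>
    moreover have "1 \<le> b"
      using a(1) bd(1) zero_less_mult_pos2[of b "int g"] g(2) by linarith
    moreover have "b \<le> int d"
      using a(2) bd g(2) by simp
    moreover have f: "?f a = (d, b)"
      using g bd by simp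
    ultimately show "?f a \<in> Sigma ?D ?B"
      using cop by simp
    show "?h (?f a) = a"
      unfolding f using bd \<open>d > 0\<close> by simp
  qed
  finally show ?thesis
    by (simp add: regular_ramanujan_sum_def)
qed

end
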